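(* Let $\mathcal{S}_3$ be the set of integer solutions, identified up to permutation of coordinates, of $(x_1+x_2+x_3)^2-(x_1+x_2+x_3)-4(x_1x_2+x_1x_3+x_2x_3)=0$, viewed as a graph with two elements adjacent if (for suitable orderings) they differ in exactly one coordinate. Let $\mathcal{S}_3^+$ and $\mathcal{S}_3^-$ be the sets of elements with $x_1+x_2+x_3+1>0$ and $<0$ respectively. Then $\mathcal{S}_3$ has exactly two connected components, namely $\mathcal{S}_3^+$ and $\mathcal{S}_3^-$. Moreover $\mathcal{S}_3^+=\mathcal{F}_3$, the set of 3-color fair games (solutions with all coordinates non-negative). *)

theory Defs
  imports Main "HOL-Library.Multiset"
begin

text \<open>An integer triple up to permutation of its coordinates is a multiset of size three.\<close>

definition fair_equation :: "int \<Rightarrow> int \<Rightarrow> int \<Rightarrow> bool" where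
  "fair_equation x1 x2 x3 \<longleftrightarrow>
     (x1 + x2 + x3)^2 - (x1 + x2 + x3) - 4 * (x1 * x2 + x1 * x3 + x2 * x3) = 0"

definition S3 :: "int multiset set" where
  "S3 = {{#x1, x2, x3#} | x1 x2 x3. fair_equation x1 x2 x3}"

definition S3_pos :: "int multiset set" where
  "S3_pos = {M \<in> S3. sum_mset M + 1 > 0}"

definition S3_neg :: "int multiset set" where
  "S3_neg = {M \<in> S3. sum_mset M + 1 < 0}"

definition fair_games3 :: "int multiset set" where
  "fair_games3 = {M \<in> S3. \<forall>x \<in># M. x \<ge> 0}"

text \<open>The lists \<open>xs\<close> and \<open>ys\<close> are the orderings of the coordinates.\<close>

definition differ_in_one :: "int multiset \<Rightarrow> int multiset \<Rightarrow> bool" where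
  "differ_in_one M N \<longleftrightarrow>
     (\<exists>xs ys. mset xs = M \<and> mset ys = N \<and> length xs = length ys \<and>
        card {i. i < length xs \<and> xs ! i \<noteq> ys ! i} = 1)"

definition S3_edges :: "(int multiset \<times> int multiset) set" where
  "S3_edges = {(M, N). M \<in> S3 \<and> N \<in> S3 \<and> differ_in_one M N}"

text \<open>An undirected graph is given by its vertex set \<open>V\<close> and a symmetric adjacency relation
  \<open>E\<close>. Its connected components are the classes of the relation ``joined by a path in \<open>V\<close>''.\<close>

definition connected_components :: "'a set \<Rightarrow> ('a \<times> 'a) set \<Rightarrow> 'a set set" where
  "connected_components V E = V // {(u, v). u \<in> V \<and> v \<in> V \<and> (u, v) \<in> (E \<inter> V \<times> V)\<^sup>*}"

lemma sym_S3_edges: "sym S3_edges"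
proof (rule symI)
  fix M N assume "(M, N) \<in> S3_edges"
  then obtain xs ys where *: "M \<in> S3" "N \<in> S3" "mset xs = M" "mset ys = N"
    "length xs = length ys" "card {i. i < length xs \<and> xs ! i \<noteq> ys ! i} = 1"
    by (auto simp: S3_edges_def differ_in_one_def)
  have "{i. i < length ys \<and> ys ! i \<noteq> xs ! i} = {i. i < length xs \<and> xs ! i \<noteq> ys ! i}"
    using *(5) by auto
  with * have "differ_in_one N M"
    unfolding differ_in_one_def by metis
  with * show "(N, M) \<in> S3_edges"
    by (simp add: S3_edges_def)
qed

end

(* Fixing two coordinates a, b, the equation is a monic quadratic in the third one, so replacing
   c by 2(a+b)+1-c moves along an edge. If a + b \<ge> 0 then both roots are non-negative, hence
   edges never leave the non-negative solutions, and these are exactly the solutions with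
   non-negative sum. Replacing the largest coordinate strictly decreases the sum unless the
   solution is (0,0,0), so the non-negative solutions are connected. The symmetry x \<mapsto> -1-x of the
   equation exchanges the two signs. *)

theory Submission
  imports Defs
begin

section \<open>The equation in power sums, and triples as multisets\<close>

lemma fair_equation_alt:
  "fair_equation a b c \<longleftrightarrow> 2 * (a^2 + b^2 + c^2) = (a + b + c)^2 + (a + b + c)"
  unfolding fair_equation_def by (auto simp: power2_eq_square algebra_simps)

lemma size_3_conv: "size M = 3 \<longleftrightarrow> (\<exists>a b c. M = {#a, b, c#})"
proof
  assume "size M = 3"
  moreover obtain xs where "M = mset xs" using ex_mset by metis
  ultimately obtain a b c where "xs = [a, b, c]"
    by (auto simp: numeral_3_eq_3 length_Suc_conv)
  with \<open>M = mset xs\<close> have "M = {#a, b, c#}" by simp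
  then show "\<exists>a b c. M = {#a, b, c#}" by blast
qed auto

text \<open>Power sums make the invariance under permutations evident.\<close>

lemma S3_iff:
  "M \<in> S3 \<longleftrightarrow> size M = 3 \<and> 2 * (\<Sum>x\<in>#M. x^2) = (sum_mset M)^2 + sum_mset M"
proof
  assume "M \<in> S3"
  then show "size M = 3 \<and> 2 * (\<Sum>x\<in>#M. x^2) = (sum_mset M)^2 + sum_mset M"
    unfolding S3_def by (auto simp: fair_equation_alt add.assoc)
next
  assume M: "size M = 3 \<and> 2 * (\<Sum>x\<in>#M. x^2) = (sum_mset M)^2 + sum_mset M"
  then obtain a b c where "M = {#a, b, c#}" by (auto simp: size_3_conv)
  with M show "M \<in> S3"
    unfolding S3_def by (auto simp: fair_equation_alt add.assoc)
qed

lemma triple_in_S3_iff: "{#a, b, c#} \<in> S3 \<longleftrightarrow> fair_equation a b c"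
  by (simp add: S3_iff fair_equation_alt add.assoc)

text \<open>Moves a chosen coordinate to the last position, where the equation is read as a
  quadratic in it.\<close>

lemma S3_remove:
  assumes "M \<in> S3" "c \<in># M"
  obtains a b where "M = {#a, b, c#}"
proof -
  obtain K where K: "M = add_mset c K"
    using assms(2) by (metis insert_DiffM)
  obtain xs where xs: "K = mset xs"
    using ex_mset by metis
  moreover have "size K = 2"
    using assms(1) K by (simp add: S3_iff)
  ultimately obtain a b where "xs = [a, b]"
    by (auto simp: numeral_2_eq_2 length_Suc_conv)
  then show thesis
    using that[of a b] K xs by (simp add: add_mset_commute)
qed

section \<open>Signs of roots and of sums\<close>

text \<open>The equation reads \<open>c^2 + (a - b)^2 = (2 * (a + b) + 1) * c + (a + b)\<close>. For
  \<open>c \<le> -1\<close> the right side is at most \<open>- (a + b) - 1 < 0\<close>, while the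
  left side is a sum of squares.\<close>

lemma fair_equation_root_nonneg:
  assumes "fair_equation a b c" "a + b \<ge> 0"
  shows "c \<ge> 0"
proof (rule ccontr)
  assume "\<not> c \<ge> 0"
  then have c: "c \<le> -1" by simp
  define q where "q = (2 * (a + b) + 1) * c"
  have "q + (a + b) = c^2 + (a - b)^2"
    using assms(1) unfolding fair_equation_def q_def by (simp add: power2_eq_square algebra_simps)
  then have "q + (a + b) \<ge> 0"
    by (metis sum_power2_ge_zero)
  moreover
  have "q \<le> (2 * (a + b) + 1) * (-1)"
    unfolding q_def using assms(2) c by (intro mult_left_mono) auto
  then have "q \<le> - (2 * a + 2 * b + 1)"
    by (simp add: algebra_simps)
  ultimately show False using assms(2) by linarith
qed

text \<open>The two roots in the third coordinate have sum \<open>2 * (a + b) + 1\<close>.\<close>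

lemma fair_equation_vieta:
  "fair_equation a b c \<Longrightarrow> fair_equation a b (2 * (a + b) + 1 - c)"
  unfolding fair_equation_def by (simp add: power2_eq_square algebra_simps)

lemma S3_pos_nonneg:
  assumes "M \<in> S3_pos" "x \<in># M"
  shows "x \<ge> 0"
proof -
  have M: "M \<in> S3" and s: "sum_mset M + 1 > 0"
    using assms(1) by (auto simp: S3_pos_def)
  obtain a b where "M = {#a, b, x#}"
    using S3_remove[OF M assms(2)] .
  with M s have "fair_equation a b x" "a + b + x \<ge> 0"
    by (auto simp: triple_in_S3_iff)
  \<comment> \<open>If \<open>x < 0\<close>, the non-negative total forces \<open>a + b > 0\<close>,
    and then the root \<open>x\<close> could not be negative.\<close>
  then show ?thesis
    using fair_equation_root_nonneg[of a b x] by linarith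
qed

lemma S3_pos_eq_fair_games3: "S3_pos = fair_games3"
proof
  show "S3_pos \<subseteq> fair_games3"
    using S3_pos_nonneg by (auto simp: fair_games3_def S3_pos_def)
  show "fair_games3 \<subseteq> S3_pos"
    by (auto simp: fair_games3_def S3_pos_def S3_def)
qed

text \<open>Sum \<open>-1\<close> would give \<open>4 * e\<^sub>2 = 2\<close>.\<close>

lemma S3_eq_Un: "S3 = S3_pos \<union> S3_neg"
proof -
  have "a + b + c \<noteq> -1" if "fair_equation a b c" for a b c
  proof
    assume "a + b + c = -1"
    with that have "2 = 4 * (a * b + a * c + b * c)"
      by (simp add: fair_equation_def)
    then show False by presburger
  qed
  then have "sum_mset M + 1 \<noteq> 0" if "M \<in> S3" for M
    using that by (fastforce simp: S3_def)
  then show ?thesis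
    by (fastforce simp: S3_pos_def S3_neg_def)
qed

lemma S3_pos_neg_disjoint: "S3_pos \<inter> S3_neg = {}"
  by (auto simp: S3_pos_def S3_neg_def)

section \<open>Edges\<close>

text \<open>Deleting the single differing position from both lists leaves the same multiset
  \<open>K\<close>. Conversely, the two entries can be put in front of one ordering of
  \<open>K\<close>.\<close>

lemma differ_in_one_iff:
  "differ_in_one M N \<longleftrightarrow> (\<exists>K c d. c \<noteq> d \<and> M = add_mset c K \<and> N = add_mset d K)"
proof
  assume "differ_in_one M N"
  then obtain xs ys where xy: "mset xs = M" "mset ys = N" "length xs = length ys"
    and "card {i. i < length xs \<and> xs ! i \<noteq> ys ! i} = 1"
    unfolding differ_in_one_def by blast
  then obtain i where i: "{i. i < length xs \<and> xs ! i \<noteq> ys ! i} = {i}"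
    by (auto simp: card_1_singleton_iff)
  then have il: "i < length xs" "xs ! i \<noteq> ys ! i" by auto
  have eq: "xs ! j = ys ! j" if "j < length xs" "j \<noteq> i" for j
    using i that by auto
  have "take i xs = take i ys" "drop (Suc i) xs = drop (Suc i) ys"
    using xy(3) il(1) by (auto intro!: nth_equalityI eq)
  then have "xs = take i xs @ xs ! i # drop (Suc i) xs" "ys = take i xs @ ys ! i # drop (Suc i) xs"
    using il(1) xy(3) by (metis id_take_nth_drop)+
  then have "M = add_mset (xs ! i) (mset (take i xs @ drop (Suc i) xs))"
    "N = add_mset (ys ! i) (mset (take i xs @ drop (Suc i) xs))"
    using xy(1,2) by (metis mset.simps(2) mset_append union_mset_add_mset_right)+
  with il(2) show "\<exists>K c d. c \<noteq> d \<and> M = add_mset c K \<and> N = add_mset d K" by blast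
next
  assume "\<exists>K c d. c \<noteq> d \<and> M = add_mset c K \<and> N = add_mset d K"
  then obtain K c d where K: "c \<noteq> d" "M = add_mset c K" "N = add_mset d K" by blast
  obtain zs where zs: "mset zs = K" using ex_mset by blast
  have "{i. i < length (c # zs) \<and> (c # zs) ! i \<noteq> (d # zs) ! i} = {0}"
    using K(1) by (auto simp: nth_Cons' split: if_splits)
  then have "card {i. i < length (c # zs) \<and> (c # zs) ! i \<noteq> (d # zs) ! i} = 1" by simp
  then show "differ_in_one M N"
    unfolding differ_in_one_def using K zs
    by (intro exI[of _ "c # zs"] exI[of _ "d # zs"]) auto
qed

text \<open>The second assumption excludes a double root, for which the move would stand
  still.\<close>

lemma S3_edge_vieta:
  assumes "fair_equation a b c" "2 * (a + b) + 1 - c \<noteq> c"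
  shows "({#a, b, c#}, {#a, b, 2 * (a + b) + 1 - c#}) \<in> S3_edges"
proof -
  have "{#a, b, c#} = add_mset c {#a, b#}"
    "{#a, b, 2 * (a + b) + 1 - c#} = add_mset (2 * (a + b) + 1 - c) {#a, b#}"
    by (simp_all add: add_mset_commute)
  then have "differ_in_one {#a, b, c#} {#a, b, 2 * (a + b) + 1 - c#}"
    unfolding differ_in_one_iff using assms(2) by metis
  then show ?thesis
    using assms(1) fair_equation_vieta[OF assms(1)] by (simp add: S3_edges_def triple_in_S3_iff)
qed

text \<open>The two coordinates kept by an edge are non-negative, so the new one is a root over a
  non-negative \<open>a + b\<close>.\<close>

lemma S3_edge_pos:
  assumes "(M, N) \<in> S3_edges" "M \<in> S3_pos"
  shows "N \<in> S3_pos"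
proof -
  have N: "N \<in> S3" and "differ_in_one M N"
    using assms(1) by (auto simp: S3_edges_def)
  then obtain K c d where K: "M = add_mset c K" "N = add_mset d K"
    by (auto simp: differ_in_one_iff)
  obtain a b where ab: "N = {#a, b, d#}"
    using S3_remove[OF N, of d] K by auto
  then have "K = {#a, b#}"
    using K by (simp add: add_mset_commute)
  then have "a \<ge> 0" "b \<ge> 0"
    using S3_pos_nonneg[OF assms(2)] K by auto
  moreover have "d \<ge> 0"
    using fair_equation_root_nonneg[of a b d] N ab calculation by (simp add: triple_in_S3_iff)
  ultimately show ?thesis
    using N ab by (simp add: S3_pos_def)
qed

section \<open>Descent to the zero solution\<close>

text \<open>If the other root \<open>c'\<close> were at least \<open>c\<close>, the product of the
  roots would give \<open>c^2 \<le> c * c' = (a - b)^2 - (a + b) \<le> c^2 - (a + b)\<close>. This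
  forces \<open>a = b = 0\<close>, hence \<open>c' = 0 < c\<close>.\<close>

lemma fair_equation_descent:
  assumes eq: "fair_equation a b c" and "0 \<le> a" "0 \<le> b" "a \<le> c" "b \<le> c" and "c \<noteq> 0"
  shows "2 * (a + b) + 1 - c < c"
proof (rule ccontr)
  define c' where "c' = 2 * (a + b) + 1 - c"
  assume "\<not> 2 * (a + b) + 1 - c < c"
  then have "c \<le> c'" by (simp add: c'_def)
  then have "c * c \<le> c * c'"
    using assms by (intro mult_left_mono) auto
  also have vieta: "c * c' = (a - b)^2 - (a + b)"
    using eq unfolding fair_equation_def c'_def by (simp add: power2_eq_square algebra_simps)
  also have "(a - b)^2 \<le> c * c"
  proof -
    have "\<bar>a - b\<bar> \<le> \<bar>c\<bar>" using assms by linarith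
    then show ?thesis by (metis abs_le_square_iff power2_eq_square)
  qed
  finally have "a + b \<le> 0" by simp
  then have ab: "a = 0" "b = 0" using assms by auto
  with vieta have "c' = 0" using \<open>c \<noteq> 0\<close> by auto
  with \<open>c \<le> c'\<close> assms show False by simp
qed

lemma S3_pos_reach_zero:
  assumes "M \<in> S3_pos"
  shows "(M, {#0, 0, 0#}) \<in> S3_edges\<^sup>*"
  using assms
proof (induction "nat (sum_mset M)" arbitrary: M rule: less_induct)
  case less
  have M: "M \<in> S3" using less.prems by (simp add: S3_pos_def)
  then have ne: "M \<noteq> {#}" by (auto simp: S3_iff)
  define c where "c = Max_mset M"
  have cM: "c \<in># M" and cmax: "\<And>x. x \<in># M \<Longrightarrow> x \<le> c"
    using ne by (auto simp: c_def)
  obtain a b where ab: "M = {#a, b, c#}"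
    using S3_remove[OF M cM] .
  have nonneg: "0 \<le> a" "0 \<le> b" "0 \<le> c"
    using S3_pos_nonneg[OF less.prems] ab by auto
  have le: "a \<le> c" "b \<le> c"
    using cmax ab by auto
  show ?case
  proof (cases "c = 0")
    case True
    with nonneg le have "a = 0" "b = 0" by auto
    with True ab show ?thesis by simp
  next
    case False
    define N where "N = {#a, b, 2 * (a + b) + 1 - c#}"
    have eq: "fair_equation a b c"
      using M ab by (simp add: triple_in_S3_iff)
    have lt: "2 * (a + b) + 1 - c < c"
      using fair_equation_descent[OF eq nonneg(1,2) le False] .
    have edge: "(M, N) \<in> S3_edges"
      using S3_edge_vieta[OF eq] lt ab by (simp add: N_def)
    then have N: "N \<in> S3_pos"
      using S3_edge_pos less.prems by blast
    \<comment> \<open>Truncation by \<open>nat\<close> keeps the inequality strict because the old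
      sum is positive.\<close>
    have "nat (sum_mset N) < nat (sum_mset M)"
      using lt nonneg ab by (simp add: N_def)
    then have "(N, {#0, 0, 0#}) \<in> S3_edges\<^sup>*"
      using less.hyps N by blast
    with edge show ?thesis by (rule converse_rtrancl_into_rtrancl)
  qed
qed

section \<open>Reflection onto the negative solutions\<close>

definition reflect :: "int multiset \<Rightarrow> int multiset" where
  "reflect M = image_mset (\<lambda>x. -1 - x) M"

lemma reflect_reflect [simp]: "reflect (reflect M) = M"
  by (simp add: reflect_def image_mset.compositionality comp_def)

lemma fair_equation_reflect:
  "fair_equation (-1 - a) (-1 - b) (-1 - c) \<longleftrightarrow> fair_equation a b c"
  unfolding fair_equation_def by (simp add: power2_eq_square algebra_simps)

lemma reflect_S3: "M \<in> S3 \<Longrightarrow> reflect M \<in> S3"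
  by (auto simp: S3_def reflect_def) (metis fair_equation_reflect)

lemma sum_mset_reflect: "M \<in> S3 \<Longrightarrow> sum_mset (reflect M) = -3 - sum_mset M"
  by (auto simp: S3_def reflect_def)

lemma reflect_S3_neg:
  assumes "M \<in> S3_neg"
  shows "reflect M \<in> S3_pos"
proof -
  have M: "M \<in> S3" "sum_mset M + 1 < 0" using assms by (auto simp: S3_neg_def)
  \<comment> \<open>Integrality alone gives only the weak inequality; \<open>S3_eq_Un\<close> rules
    out equality.\<close>
  have "sum_mset (reflect M) + 1 \<ge> 0"
    using sum_mset_reflect[OF M(1)] M(2) by simp
  then show ?thesis
    using reflect_S3[OF M(1)] S3_eq_Un by (auto simp: S3_neg_def)
qed

lemma reflect_edge:
  assumes "(M, N) \<in> S3_edges"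
  shows "(reflect M, reflect N) \<in> S3_edges"
proof -
  have MN: "M \<in> S3" "N \<in> S3" "differ_in_one M N"
    using assms by (auto simp: S3_edges_def)
  then obtain K c d where "c \<noteq> d" "M = add_mset c K" "N = add_mset d K"
    by (auto simp: differ_in_one_iff)
  then have "-1 - c \<noteq> -1 - d" "reflect M = add_mset (-1 - c) (reflect K)"
    "reflect N = add_mset (-1 - d) (reflect K)"
    by (auto simp: reflect_def)
  then have "differ_in_one (reflect M) (reflect N)"
    unfolding differ_in_one_iff by blast
  with MN show ?thesis by (simp add: S3_edges_def reflect_S3)
qed

lemma reflect_path: "(M, N) \<in> S3_edges\<^sup>* \<Longrightarrow> (reflect M, reflect N) \<in> S3_edges\<^sup>*"
  by (induction rule: rtrancl_induct) (auto intro: reflect_edge rtrancl_into_rtrancl)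

section \<open>Paths and connected components\<close>

lemma S3_path_sym: "(M, N) \<in> S3_edges\<^sup>* \<Longrightarrow> (N, M) \<in> S3_edges\<^sup>*"
  using sym_rtrancl[OF sym_S3_edges] by (rule symD)

lemma S3_pos_connected:
  "M \<in> S3_pos \<Longrightarrow> N \<in> S3_pos \<Longrightarrow> (M, N) \<in> S3_edges\<^sup>*"
  using S3_pos_reach_zero S3_path_sym by (meson rtrancl_trans)

text \<open>A path between the reflected solutions is reflected back, \<open>reflect\<close> being
  an involution.\<close>

lemma S3_neg_connected:
  assumes "M \<in> S3_neg" "N \<in> S3_neg"
  shows "(M, N) \<in> S3_edges\<^sup>*"
  using reflect_path[OF S3_pos_connected[OF assms[THEN reflect_S3_neg]]] by simp

lemma S3_path_pos:
  assumes "(M, N) \<in> S3_edges\<^sup>*" "M \<in> S3_pos"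
  shows "N \<in> S3_pos"
  using assms by (induction rule: rtrancl_induct) (auto intro: S3_edge_pos)

theorem theorem4p9:
  shows "connected_components S3 S3_edges = {S3_pos, S3_neg}
       \<and> card (connected_components S3 S3_edges) = 2
       \<and> S3_pos = fair_games3"
proof -
  define R where "R = {(u, v). u \<in> S3 \<and> v \<in> S3 \<and> (u, v) \<in> (S3_edges \<inter> S3 \<times> S3)\<^sup>*}"
  have "S3_edges \<inter> S3 \<times> S3 = S3_edges"
    by (auto simp: S3_edges_def)
  then have R: "(u, v) \<in> R \<longleftrightarrow> u \<in> S3 \<and> v \<in> S3 \<and> (u, v) \<in> S3_edges\<^sup>*" for u v
    by (simp add: R_def)
  have S3: "u \<in> S3 \<longleftrightarrow> u \<in> S3_pos \<or> u \<in> S3_neg" for u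
    using S3_eq_Un by blast
  have not_both: "\<not> (u \<in> S3_pos \<and> u \<in> S3_neg)" for u
    using S3_pos_neg_disjoint by blast
  have pos: "R `` {u} = S3_pos" if "u \<in> S3_pos" for u
    using that by (auto simp: R S3 S3_pos_connected dest: S3_path_pos)
  have neg: "R `` {u} = S3_neg" if "u \<in> S3_neg" for u
  proof -
    \<comment> \<open>A path from \<open>u\<close> into \<open>S3_pos\<close>, walked backwards,
      would place \<open>u\<close> itself in \<open>S3_pos\<close>.\<close>
    have "v \<notin> S3_pos" if "(u, v) \<in> S3_edges\<^sup>*" for v
      using S3_path_pos[OF S3_path_sym[OF that]] not_both \<open>u \<in> S3_neg\<close> by blast
    with that show ?thesis by (auto simp: R S3 S3_neg_connected)
  qed
  \<comment> \<open>This solution and its reflection \<open>{#-1, -1, -1#}\<close> witness that both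
    classes occur; the first also separates the two sets.\<close>
  have p: "{#0, 0, 0#} \<in> S3_pos"
    by (simp add: S3_pos_def triple_in_S3_iff fair_equation_def)
  have n: "{#-1, -1, -1#} \<in> S3_neg"
    by (simp add: S3_neg_def triple_in_S3_iff fair_equation_def)
  have "connected_components S3 S3_edges = (\<Union>u\<in>S3. {R `` {u}})"
    by (simp add: connected_components_def quotient_def R_def)
  also have "\<dots> = {S3_pos, S3_neg}"
  proof
    show "(\<Union>u\<in>S3. {R `` {u}}) \<subseteq> {S3_pos, S3_neg}"
      using pos neg S3 by blast
    show "{S3_pos, S3_neg} \<subseteq> (\<Union>u\<in>S3. {R `` {u}})"
      using pos[OF p] neg[OF n] p n S3 by blast
  qed
  finally have "connected_components S3 S3_edges = {S3_pos, S3_neg}" .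
  moreover have "S3_pos \<noteq> S3_neg"
    using p S3_pos_neg_disjoint by blast
  ultimately show ?thesis
    using S3_pos_eq_fair_games3 by simp
qed

end
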